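(* Let $K$ be the subgroup of $F(a,b)\times F(c,d)$ generated by the six elements $ba^{-1}, ca^{-1}, da^{-1}, cb^{-1}, db^{-1}, dc^{-1}$. Then $K$ is $1$-ended.
   Context: $F(a,b)$ and $F(c,d)$ are the free groups on $\{a,b\}$ and $\{c,d\}$ respectively; $a,b$ and $c,d$ are identified with their images in the direct product $F(a,b)\times F(c,d)$. The group $K$ equals the kernel of the homomorphism $F(a,b)\times F(c,d)\to\mathbb Z$ sending each of $a,b,c,d$ to $1$ (this is the Bieri–Stallings group $B_2$). A finitely generated group is $1$-ended if its Cayley graph with respect to a finite generating set has exactly one end. *)

theory Defs
  imports "HOL-Algebra.Generated_Groups" "Graph_Theory.Digraph_Component"
begin

section \<open>Free groups\<close>

text \<open>
  A letter \<open>(x, True)\<close> stands for the generator \<open>x\<close>, and \<open>(x, False)\<close> for its inverse.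
  The free group on \<open>X\<close> consists of the freely reduced words in these letters;
  two words are multiplied by concatenation followed by free reduction.
\<close>

definition inv_letter :: "'x \<times> bool \<Rightarrow> 'x \<times> bool" where
  "inv_letter l = (fst l, \<not> snd l)"

definition reduced :: "('x \<times> bool) list \<Rightarrow> bool" where
  "reduced w \<longleftrightarrow> successively (\<lambda>l l'. l' \<noteq> inv_letter l) w"

fun push_letter :: "'x \<times> bool \<Rightarrow> ('x \<times> bool) list \<Rightarrow> ('x \<times> bool) list" where
  "push_letter l [] = [l]"
| "push_letter l (l' # w) = (if l' = inv_letter l then w else l # l' # w)"

definition word_mult :: "('x \<times> bool) list \<Rightarrow> ('x \<times> bool) list \<Rightarrow> ('x \<times> bool) list" where
  "word_mult u v = foldr push_letter u v"

definition free_group :: "'x set \<Rightarrow> ('x \<times> bool) list monoid" where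
  "free_group X =
     \<lparr>carrier = {w. reduced w \<and> fst ` set w \<subseteq> X}, monoid.mult = word_mult, one = []\<rparr>"

definition free_gen :: "'x \<Rightarrow> ('x \<times> bool) list" where
  "free_gen x = [(x, True)]"

lemma inv_letter_inv_letter [simp]: "inv_letter (inv_letter l) = l"
  by (simp add: inv_letter_def)

lemma inv_letter_neq [simp]: "inv_letter l \<noteq> l" "l \<noteq> inv_letter l"
  by (auto simp: inv_letter_def prod_eq_iff)

lemma fst_inv_letter [simp]: "fst (inv_letter l) = fst l"
  by (simp add: inv_letter_def)

lemma reduced_Nil [simp]: "reduced []"
  by (simp add: reduced_def)

lemma reduced_ConsD: "reduced (l # w) \<Longrightarrow> reduced w"
  by (cases w) (auto simp: reduced_def)

lemma reduced_push_letter: "reduced w \<Longrightarrow> reduced (push_letter l w)"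
  by (cases w) (auto simp: reduced_def successively_Cons)

lemma push_letter_reduced: "reduced (l # w) \<Longrightarrow> push_letter l w = l # w"
  by (cases w) (auto simp: reduced_def)

lemma push_letter_cancel: "reduced w \<Longrightarrow> push_letter (inv_letter l) (push_letter l w) = w"
  by (cases w) (auto simp: push_letter_reduced)

lemma set_push_letter: "set (push_letter l w) \<subseteq> insert l (set w)"
  by (cases w) auto

lemma reduced_word_mult: "reduced v \<Longrightarrow> reduced (word_mult u v)"
  by (induction u) (auto simp: word_mult_def reduced_push_letter)

lemma set_word_mult: "set (word_mult u v) \<subseteq> set u \<union> set v"
  by (induction u) (use set_push_letter in \<open>fastforce simp: word_mult_def\<close>)+

lemma word_mult_push_letter:
  assumes "reduced v" "reduced w"
  shows "word_mult (push_letter l v) w = push_letter l (word_mult v w)"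
proof (cases v)
  case (Cons l' v')
  then show ?thesis
    using push_letter_cancel[of "word_mult v' w" "inv_letter l"] reduced_word_mult[OF assms(2), of v']
    by (auto simp: word_mult_def)
qed (simp add: word_mult_def)

lemma word_mult_assoc:
  assumes "reduced v" "reduced w"
  shows "word_mult (word_mult u v) w = word_mult u (word_mult v w)"
proof (induction u)
  case (Cons l u)
  then show ?case
    using word_mult_push_letter[OF reduced_word_mult[OF assms(1), of u] assms(2), of l]
    by (simp add: word_mult_def)
qed (simp add: word_mult_def)

lemma word_mult_Nil_left: "word_mult [] u = u"
  by (simp add: word_mult_def)

lemma word_mult_Nil_right: "reduced u \<Longrightarrow> word_mult u [] = u"
proof (induction u)
  case (Cons l u)
  then show ?case
    using push_letter_reduced[OF Cons.prems] reduced_ConsD[OF Cons.prems] by (simp add: word_mult_def)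
qed (simp add: word_mult_def)

lemma reduced_inverse_word: "reduced w \<Longrightarrow> reduced (rev (map inv_letter w))"
  unfolding reduced_def successively_rev successively_map
  by (erule successively_mono) auto

lemma word_mult_inverse_word: "reduced w \<Longrightarrow> word_mult (rev (map inv_letter w)) w = []"
proof (induction w)
  case (Cons l w)
  then show ?case
    using reduced_ConsD[OF Cons.prems] by (simp add: word_mult_def)
qed (simp add: word_mult_def)

lemma group_free_group: "group (free_group X)"
proof (rule groupI)
  fix u v assume "u \<in> carrier (free_group X)" "v \<in> carrier (free_group X)"
  then show "u \<otimes>\<^bsub>free_group X\<^esub> v \<in> carrier (free_group X)"
    using order_trans[OF image_mono[OF set_word_mult[of u v], of fst], of X]
    by (simp add: free_group_def reduced_word_mult image_Un)
next
  fix u assume "u \<in> carrier (free_group X)"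
  then have "rev (map inv_letter u) \<in> carrier (free_group X)"
      "rev (map inv_letter u) \<otimes>\<^bsub>free_group X\<^esub> u = \<one>\<^bsub>free_group X\<^esub>"
    by (auto simp: free_group_def reduced_inverse_word word_mult_inverse_word)
  then show "\<exists>v\<in>carrier (free_group X). v \<otimes>\<^bsub>free_group X\<^esub> u = \<one>\<^bsub>free_group X\<^esub>"
    by blast
qed (simp_all add: free_group_def word_mult_assoc word_mult_Nil_left)

lemma free_gen_closed: "x \<in> X \<Longrightarrow> free_gen x \<in> carrier (free_group X)"
  by (simp add: free_group_def free_gen_def reduced_def)


section \<open>Ends of graphs\<close>

text \<open>
  Undirected graphs are represented as symmetric digraphs. Two rays are equivalent if for every
  finite set \<open>X\<close> of vertices they have tails in the same component of the graph minus \<open>X\<close>;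
  an end is an equivalence class of rays.
\<close>

definition ray :: "('v, 'e) pre_digraph \<Rightarrow> (nat \<Rightarrow> 'v) \<Rightarrow> bool" where
  "ray G r \<longleftrightarrow> inj r \<and> range r \<subseteq> verts G \<and> (\<forall>n. r n \<rightarrow>\<^bsub>G\<^esub> r (Suc n))"

definition ray_equiv :: "('v, 'e) pre_digraph \<Rightarrow> ((nat \<Rightarrow> 'v) \<times> (nat \<Rightarrow> 'v)) set" where
  "ray_equiv G = {(r, r'). ray G r \<and> ray G r' \<and>
     (\<forall>X. finite X \<and> X \<subseteq> verts G \<longrightarrow>
        (\<exists>N. \<forall>m\<ge>N. \<forall>n\<ge>N. r m \<rightarrow>\<^sup>*\<^bsub>G \<restriction> (verts G - X)\<^esub> r' n))}"

definition ends :: "('v, 'e) pre_digraph \<Rightarrow> (nat \<Rightarrow> 'v) set set" where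
  "ends G = {r. ray G r} // ray_equiv G"

lemma symmetric_induce_subgraph:
  assumes "symmetric G"
  shows "symmetric (G \<restriction> A)"
  using assms by (fastforce simp: symmetric_conv)

lemma reachable_ray_tail:
  assumes r: "ray G r" and N: "\<And>n. n \<ge> N \<Longrightarrow> r n \<notin> X" and mn: "N \<le> m" "m \<le> n"
  shows "r m \<rightarrow>\<^sup>*\<^bsub>G \<restriction> (verts G - X)\<^esub> r n"
  using mn(2)
proof (induction n rule: dec_induct)
  case base
  show ?case
    using r N[OF mn(1)] by (auto simp: ray_def reachable_def)
next
  case (step n)
  have "r n \<in> verts G - X" "r (Suc n) \<in> verts G - X"
    using r N[of n] N[of "Suc n"] step mn(1) by (auto simp: ray_def)
  moreover have "r n \<rightarrow>\<^bsub>G\<^esub> r (Suc n)"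
    using r by (simp add: ray_def)
  ultimately have "r n \<rightarrow>\<^bsub>G \<restriction> (verts G - X)\<^esub> r (Suc n)"
    by (auto simp: arcs_ends_conv image_iff)
  with step \<open>r (Suc n) \<in> verts G - X\<close> show ?case
    by (auto simp: reachable_def intro: rtrancl_on_into_rtrancl_on)
qed

lemma equiv_ray_equiv:
  assumes "wf_digraph G" "symmetric G"
  shows "equiv {r. ray G r} (ray_equiv G)"
proof (rule equivI)
  note sub_sym = symmetric_induce_subgraph[OF assms(2)]
  show "ray_equiv G \<subseteq> {r. ray G r} \<times> {r. ray G r}"
    by (auto simp: ray_equiv_def)
  show "refl_on {r. ray G r} (ray_equiv G)"
  proof (rule refl_onI)
    fix r assume "r \<in> {r. ray G r}"
    then have r: "ray G r" by simp
    have "\<exists>N. \<forall>m\<ge>N. \<forall>n\<ge>N. r m \<rightarrow>\<^sup>*\<^bsub>G \<restriction> (verts G - X)\<^esub> r n" if "finite X" for X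
    proof -
      have "finite (r -` X)"
        using r that by (auto simp: ray_def intro: finite_vimageI)
      then obtain N where "r -` X \<subseteq> {..<N}"
        using finite_nat_iff_bounded by auto
      then have N: "r n \<notin> X" if "n \<ge> N" for n
        using that by fastforce
      have "r m \<rightarrow>\<^sup>*\<^bsub>G \<restriction> (verts G - X)\<^esub> r n" if "m \<ge> N" "n \<ge> N" for m n
        using reachable_ray_tail[OF r N, of N m n] reachable_ray_tail[OF r N, of N n m] that
          symmetric_reachable[OF sub_sym] by (meson nat_le_linear)
      then show ?thesis by blast
    qed
    with r show "(r, r) \<in> ray_equiv G"
      by (simp add: ray_equiv_def)
  qed
  show "sym (ray_equiv G)"
  proof (rule symI)
    fix r s assume rs: "(r, s) \<in> ray_equiv G"
    have "\<exists>N. \<forall>m\<ge>N. \<forall>n\<ge>N. s m \<rightarrow>\<^sup>*\<^bsub>G \<restriction> (verts G - X)\<^esub> r n" if X: "finite X" "X \<subseteq> verts G" for X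
    proof -
      obtain N where "\<forall>m\<ge>N. \<forall>n\<ge>N. r m \<rightarrow>\<^sup>*\<^bsub>G \<restriction> (verts G - X)\<^esub> s n"
        using rs X unfolding ray_equiv_def by blast
      then have "\<forall>m\<ge>N. \<forall>n\<ge>N. s m \<rightarrow>\<^sup>*\<^bsub>G \<restriction> (verts G - X)\<^esub> r n"
        by (metis symmetric_reachable[OF sub_sym])
      then show ?thesis by blast
    qed
    with rs show "(s, r) \<in> ray_equiv G"
      by (simp add: ray_equiv_def)
  qed
  show "trans (ray_equiv G)"
  proof (rule transI)
    fix r s t assume rs: "(r, s) \<in> ray_equiv G" and st: "(s, t) \<in> ray_equiv G"
    have "\<exists>N. \<forall>m\<ge>N. \<forall>n\<ge>N. r m \<rightarrow>\<^sup>*\<^bsub>G \<restriction> (verts G - X)\<^esub> t n" if X: "finite X" "X \<subseteq> verts G" for X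
    proof -
      obtain N1 where N1: "\<forall>m\<ge>N1. \<forall>n\<ge>N1. r m \<rightarrow>\<^sup>*\<^bsub>G \<restriction> (verts G - X)\<^esub> s n"
        using rs X unfolding ray_equiv_def by blast
      obtain N2 where N2: "\<forall>m\<ge>N2. \<forall>n\<ge>N2. s m \<rightarrow>\<^sup>*\<^bsub>G \<restriction> (verts G - X)\<^esub> t n"
        using st X unfolding ray_equiv_def by blast
      have "r m \<rightarrow>\<^sup>*\<^bsub>G \<restriction> (verts G - X)\<^esub> t n" if "m \<ge> max N1 N2" "n \<ge> max N1 N2" for m n
        using N1[rule_format, of m "max N1 N2"] N2[rule_format, of "max N1 N2" n] that
        unfolding reachable_def by (auto intro: rtrancl_on_trans)
      then show ?thesis by blast
    qed
    with rs st show "(r, t) \<in> ray_equiv G"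
      by (simp add: ray_equiv_def)
  qed
qed


section \<open>One-ended groups\<close>

definition cayley_graph :: "('g, 'm) monoid_scheme \<Rightarrow> 'g set \<Rightarrow> ('g, 'g \<times> 'g) pre_digraph" where
  "cayley_graph G S =
     \<lparr>verts = carrier G,
      arcs = {(g, h). g \<in> carrier G \<and> h \<in> carrier G \<and> (\<exists>s\<in>S. h = g \<otimes>\<^bsub>G\<^esub> s \<or> g = h \<otimes>\<^bsub>G\<^esub> s)},
      tail = fst, head = snd\<rparr>"

definition finite_generating_set :: "('g, 'm) monoid_scheme \<Rightarrow> 'g set \<Rightarrow> bool" where
  "finite_generating_set G S \<longleftrightarrow> finite S \<and> S \<subseteq> carrier G \<and> generate G S = carrier G"

text \<open>
  The number of ends of the Cayley graph is the same for all finite generating sets. The definition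
  does not presuppose this: it asks for a finite generating set to exist, and for the Cayley graphs
  of all of them to have exactly one end.
\<close>

definition one_ended :: "('g, 'm) monoid_scheme \<Rightarrow> bool" where
  "one_ended G \<longleftrightarrow> (\<exists>S. finite_generating_set G S) \<and>
     (\<forall>S. finite_generating_set G S \<longrightarrow> card (ends (cayley_graph G S)) = 1)"

lemma cayley_graph_wf_symmetric:
  "wf_digraph (cayley_graph G S)" "symmetric (cayley_graph G S)"
  by (auto simp: cayley_graph_def wf_digraph_def symmetric_conv)

end

theory Submission
  imports Defs
begin

text \<open>
  \<open>K\<close> is the group of pairs \<open>(u, v)\<close> of reduced words whose exponent sums add up to zero. It is
  generated by the pairs of letters with opposite signs, and multiplication by such a generator moves
  \<open>u\<close> along an edge of one tree and \<open>v\<close> along an edge of the other, in opposite directions. Once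
  \<open>u\<close> is longer than \<open>n\<close>, the coordinate \<open>v\<close> can be moved anywhere while \<open>u\<close> only grows, and
  vice versa; hence all pairs outside the box of words of length at most \<open>n\<close> are connected outside
  that box. An edge for these generators becomes a path of bounded length in the Cayley graph of any
  other finite generating set, so this passes to all Cayley graphs. A ray exists by
  Koenig's lemma.
\<close>

section \<open>Rays and ends\<close>

text \<open>Cut a path at its last visit to \<open>v\<close>: what follows uses no edge that enters
  \<open>v\<close>.\<close>

lemma rtrancl_last_visit:
  assumes "(v, x) \<in> E\<^sup>*"
  shows "x = v \<or> (\<exists>w. (v, w) \<in> E - UNIV \<times> {v} \<and> (w, x) \<in> (E - UNIV \<times> {v})\<^sup>*)"
  using assms
proof (induction rule: rtrancl_induct)
  case (step x y)
  show ?case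
  proof (cases "y = v")
    case False
    then have xy: "(x, y) \<in> E - UNIV \<times> {v}"
      using step by auto
    from step.IH show ?thesis
      using xy by (blast intro: rtrancl_into_rtrancl)
  qed simp
qed simp

text \<open>Walk so that infinitely many vertices stay reachable, and on leaving a vertex discard
  every edge into it; the walk then never returns.\<close>

lemma koenig:
  assumes fin: "\<And>x. finite (E `` {x})" and inf: "infinite (E\<^sup>* `` {v0})"
  shows "\<exists>r :: nat \<Rightarrow> 'a. inj r \<and> (\<forall>n. (r n, r (Suc n)) \<in> E)"
proof -
  \<comment> \<open>A state consists of the current vertex and the set of edges still
    allowed.\<close>
  define P where "P s \<longleftrightarrow> snd s \<subseteq> E \<and> infinite ((snd s)\<^sup>* `` {fst s})" for s :: "'a \<times> ('a \<times> 'a) set"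
  define Q where "Q s t \<longleftrightarrow> snd t = snd s - UNIV \<times> {fst s} \<and> (fst s, fst t) \<in> snd t"
    for s t :: "'a \<times> ('a \<times> 'a) set"
  have step: "\<exists>t. P t \<and> Q s t" if "P s" for s
  proof -
    obtain v D where s: "s = (v, D)" by fastforce
    define D' where "D' = D - UNIV \<times> {v}"
    \<comment> \<open>By the last visit to \<open>v\<close>, finitely many successors account for
      all reachable vertices but \<open>v\<close>, so one of them reaches infinitely many within
      \<open>D'\<close>.\<close>
    have "D\<^sup>* `` {v} \<subseteq> insert v (\<Union>w\<in>D' `` {v}. D'\<^sup>* `` {w})"
      using rtrancl_last_visit[of v _ D] unfolding D'_def by blast
    moreover have "infinite (D\<^sup>* `` {v})" "D \<subseteq> E"
      using that by (auto simp: P_def s)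
    moreover from \<open>D \<subseteq> E\<close> have "finite (D' `` {v})"
      by (intro finite_subset[OF _ fin[of v]]) (auto simp: D'_def)
    ultimately obtain w where "w \<in> D' `` {v}" "infinite (D'\<^sup>* `` {w})"
      by (meson finite_UN_I finite_insert finite_subset)
    with \<open>D \<subseteq> E\<close> have "P (w, D')" "Q s (w, D')"
      by (auto simp: P_def Q_def D'_def s)
    then show ?thesis by blast
  qed
  moreover have "P (v0, E)"
    using inf by (simp add: P_def)
  ultimately obtain f where f: "\<And>n. P (f n)" "\<And>n. Q (f n) (f (Suc n))"
    using dependent_nat_choice[of "\<lambda>_. P" "\<lambda>_. Q"] by metis
  have dec: "snd (f n) \<subseteq> snd (f m)" if "m \<le> n" for m n
    using that by (induction n rule: dec_induct) (use f(2) in \<open>auto simp: Q_def\<close>)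
  have arc: "(fst (f n), fst (f (Suc n))) \<in> snd (f (Suc n))" for n
    using f(2)[of n] unfolding Q_def by (rule conjunct2)
  \<comment> \<open>The edge into \<open>fst (f n)\<close> lies in \<open>snd (f (Suc m))\<close>,
    from which every edge into \<open>fst (f m)\<close> is gone.\<close>
  have "fst (f m) \<noteq> fst (f n)" if "m < n" for m n
  proof -
    from that obtain k where n: "n = Suc (m + k)"
      using less_imp_Suc_add by blast
    then have "(fst (f (m + k)), fst (f n)) \<in> snd (f (Suc m))"
      using arc[of "m + k"] dec[of "Suc m" "Suc (m + k)"] by auto
    moreover have "snd (f (Suc m)) = snd (f m) - UNIV \<times> {fst (f m)}"
      using f(2)[of m] unfolding Q_def by (rule conjunct1)
    ultimately show ?thesis by auto
  qed
  then have "inj (\<lambda>n. fst (f n))"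
    by (metis injI linorder_less_linear)
  moreover have "(fst (f n), fst (f (Suc n))) \<in> E" for n
    using arc[of n] f(1)[of "Suc n"] by (auto simp: P_def)
  ultimately show ?thesis by blast
qed

text \<open>Injective rays leave every finite set, so all of them end up outside \<open>Y\<close>
  and are equivalent; \<open>r\<close> ensures that there is an end. \<open>Y\<close> may exceed
  \<open>X\<close>, which leaves room for changing the generating set.\<close>

lemma card_ends_eq_1:
  assumes "ray G r"
    and conn: "\<And>X. finite X \<Longrightarrow> X \<subseteq> verts G \<Longrightarrow>
      \<exists>Y. finite Y \<and> (\<forall>g\<in>verts G - Y. \<forall>h\<in>verts G - Y. g \<rightarrow>\<^sup>*\<^bsub>G \<restriction> (verts G - X)\<^esub> h)"
  shows "card (ends G) = 1"
proof -
  have "(s, t) \<in> ray_equiv G" if s: "ray G s" and t: "ray G t" for s t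
  proof -
    have "\<exists>N. \<forall>m\<ge>N. \<forall>n\<ge>N. s m \<rightarrow>\<^sup>*\<^bsub>G \<restriction> (verts G - X)\<^esub> t n"
      if X: "finite X" "X \<subseteq> verts G" for X
    proof -
      obtain Y where Y: "finite Y"
        "\<forall>g\<in>verts G - Y. \<forall>h\<in>verts G - Y. g \<rightarrow>\<^sup>*\<^bsub>G \<restriction> (verts G - X)\<^esub> h"
        using conn[OF X] by blast
      have "finite (s -` Y \<union> t -` Y)"
        using Y(1) s t by (auto simp: ray_def intro: finite_vimageI)
      then obtain N where N: "s -` Y \<union> t -` Y \<subseteq> {..<N}"
        using finite_nat_iff_bounded by auto
      have "s m \<in> verts G - Y \<and> t n \<in> verts G - Y" if "m \<ge> N" "n \<ge> N" for m n
      proof -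
        have "m \<notin> s -` Y" "n \<notin> t -` Y"
          using N that by auto
        with s t show ?thesis by (auto simp: ray_def)
      qed
      with Y(2) show ?thesis by blast
    qed
    with s t show ?thesis by (simp add: ray_equiv_def)
  qed
  then have "ray_equiv G `` {s} = {s. ray G s}" if "ray G s" for s
    using that by (auto simp: ray_equiv_def)
  with assms(1) have "ends G = {{s. ray G s}}"
    by (auto simp: ends_def quotient_def)
  then show ?thesis by simp
qed

section \<open>Cayley graphs\<close>

lemma verts_cayley_graph [simp]: "verts (cayley_graph G S) = carrier G"
  by (simp add: cayley_graph_def)

lemma adj_cayley_graph:
  "g \<rightarrow>\<^bsub>cayley_graph G S\<^esub> h \<longleftrightarrow>
    g \<in> carrier G \<and> h \<in> carrier G \<and> (\<exists>s\<in>S. h = g \<otimes>\<^bsub>G\<^esub> s \<or> g = h \<otimes>\<^bsub>G\<^esub> s)"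
  by (auto simp: arcs_ends_conv cayley_graph_def image_iff)

section \<open>Paths in Cayley graphs avoiding a finite set\<close>

context group
begin

lemma wf_digraph_cayley_minus:
  "wf_digraph (cayley_graph G S \<restriction> (carrier G - X))"
  using cayley_graph_wf_symmetric(1) by (rule wf_digraph.wellformed_induce_subgraph)

lemma adj_cayley_minus:
  "g \<rightarrow>\<^bsub>cayley_graph G S \<restriction> (carrier G - X)\<^esub> h \<longleftrightarrow>
    g \<in> carrier G - X \<and> h \<in> carrier G - X \<and> (\<exists>s\<in>S. h = g \<otimes> s \<or> g = h \<otimes> s)"
  by (auto simp: arcs_ends_conv cayley_graph_def image_iff)

text \<open>Fix a word in \<open>S\<close> for \<open>t\<close>; \<open>P\<close> collects the
  products of its initial segments. Translation by \<open>g\<close> gives the path from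
  \<open>g\<close>, so one \<open>P\<close> serves all \<open>g\<close> and
  \<open>X\<close>.\<close>

lemma cayley_path:
  assumes S: "S \<subseteq> carrier G" and t: "t \<in> generate G S"
  shows "\<exists>P. finite P \<and> P \<subseteq> carrier G \<and> (\<forall>X. \<forall>g\<in>carrier G. (\<forall>p\<in>P. g \<otimes> p \<notin> X) \<longrightarrow>
    g \<rightarrow>\<^sup>*\<^bsub>cayley_graph G S \<restriction> (carrier G - X)\<^esub> (g \<otimes> t))"
  using t
proof induction
  case one
  have "g \<rightarrow>\<^sup>*\<^bsub>cayley_graph G S \<restriction> (carrier G - X)\<^esub> (g \<otimes> \<one>)"
    if "g \<in> carrier G" "g \<otimes> \<one> \<notin> X" for X g
    using that wf_digraph.reachable_refl[OF wf_digraph_cayley_minus] by simp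
  then show ?case by (intro exI[of _ "{\<one>}"]) auto
next
  case (incl s)
  then have "s \<in> carrier G" using S by blast
  have "g \<rightarrow>\<^sup>*\<^bsub>cayley_graph G S \<restriction> (carrier G - X)\<^esub> (g \<otimes> s)"
    if "g \<in> carrier G" "g \<otimes> \<one> \<notin> X" "g \<otimes> s \<notin> X" for X g
    using that \<open>s \<in> carrier G\<close> incl
    by (intro wf_digraph.reachable_adjI[OF wf_digraph_cayley_minus]) (auto simp: adj_cayley_minus)
  then show ?case using \<open>s \<in> carrier G\<close> by (intro exI[of _ "{\<one>, s}"]) auto
next
  case (inv s)
  then have "s \<in> carrier G" using S by blast
  have "g \<rightarrow>\<^sup>*\<^bsub>cayley_graph G S \<restriction> (carrier G - X)\<^esub> (g \<otimes> inv s)"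
    if "g \<in> carrier G" "g \<otimes> \<one> \<notin> X" "g \<otimes> inv s \<notin> X" for X g
    using that \<open>s \<in> carrier G\<close> inv
    by (intro wf_digraph.reachable_adjI[OF wf_digraph_cayley_minus])
      (auto simp: adj_cayley_minus m_assoc intro!: bexI[of _ s])
  then show ?case using \<open>s \<in> carrier G\<close> by (intro exI[of _ "{\<one>, inv s}"]) auto
next
  case (eng h1 h2)
  obtain P1 where P1: "finite P1" "P1 \<subseteq> carrier G"
    "\<forall>X. \<forall>g\<in>carrier G. (\<forall>p\<in>P1. g \<otimes> p \<notin> X) \<longrightarrow>
      g \<rightarrow>\<^sup>*\<^bsub>cayley_graph G S \<restriction> (carrier G - X)\<^esub> (g \<otimes> h1)"
    using eng.IH(1) by (elim exE conjE)
  obtain P2 where P2: "finite P2" "P2 \<subseteq> carrier G"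
    "\<forall>X. \<forall>g\<in>carrier G. (\<forall>p\<in>P2. g \<otimes> p \<notin> X) \<longrightarrow>
      g \<rightarrow>\<^sup>*\<^bsub>cayley_graph G S \<restriction> (carrier G - X)\<^esub> (g \<otimes> h2)"
    using eng.IH(2) by (elim exE conjE)
  have h: "h1 \<in> carrier G" "h2 \<in> carrier G"
    using eng.hyps generate_in_carrier[OF S] by auto
  \<comment> \<open>The path for \<open>h2\<close> starts at \<open>g \<otimes> h1\<close>, so seen
    from \<open>g\<close> its vertices are \<open>P2\<close> shifted by \<open>h1\<close>.\<close>
  have "g \<rightarrow>\<^sup>*\<^bsub>cayley_graph G S \<restriction> (carrier G - X)\<^esub> (g \<otimes> (h1 \<otimes> h2))"
    if g: "g \<in> carrier G" and X: "\<forall>p\<in>P1 \<union> (\<otimes>) h1 ` P2. g \<otimes> p \<notin> X" for X g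
  proof -
    have "g \<otimes> h1 \<otimes> p \<notin> X" if "p \<in> P2" for p
      using X g h P2(2) that by (auto simp: m_assoc subset_iff)
    with P2(3)[rule_format, of "g \<otimes> h1" X] have "(g \<otimes> h1) \<rightarrow>\<^sup>*\<^bsub>cayley_graph G S \<restriction> (carrier G - X)\<^esub> (g \<otimes> (h1 \<otimes> h2))"
      using g h by (simp add: m_assoc)
    moreover have "g \<rightarrow>\<^sup>*\<^bsub>cayley_graph G S \<restriction> (carrier G - X)\<^esub> (g \<otimes> h1)"
      using P1(3)[rule_format, OF g] X by blast
    ultimately show ?thesis
      using wf_digraph.reachable_trans[OF wf_digraph_cayley_minus] by blast
  qed
  then show ?case
    using P1 P2 h by (intro exI[of _ "P1 \<union> (\<otimes>) h1 ` P2"]) auto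
qed

text \<open>The path from \<open>g\<close> for \<open>t\<close> can meet \<open>X\<close> only if
  \<open>g = x \<otimes> inv p\<close> with \<open>x\<close> in \<open>X\<close> and
  \<open>p\<close> among the finitely many positions of that path. These elements form
  \<open>B\<close>.\<close>

lemma cayley_path_avoiding:
  assumes S: "finite_generating_set G S"
    and "finite T" "T \<subseteq> carrier G" and X: "finite X" "X \<subseteq> carrier G"
  shows "\<exists>B. finite B \<and> (\<forall>g\<in>carrier G - B. \<forall>t\<in>T.
    g \<rightarrow>\<^sup>*\<^bsub>cayley_graph G S \<restriction> (carrier G - X)\<^esub> (g \<otimes> t))"
proof -
  have "\<exists>P. finite P \<and> P \<subseteq> carrier G \<and> (\<forall>X. \<forall>g\<in>carrier G. (\<forall>p\<in>P. g \<otimes> p \<notin> X) \<longrightarrow>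
    g \<rightarrow>\<^sup>*\<^bsub>cayley_graph G S \<restriction> (carrier G - X)\<^esub> (g \<otimes> t))" if "t \<in> T" for t
    using that assms cayley_path[of S t] by (auto simp: finite_generating_set_def)
  then obtain P where P: "\<And>t. t \<in> T \<Longrightarrow> finite (P t) \<and> P t \<subseteq> carrier G"
    "\<And>t X g. t \<in> T \<Longrightarrow> g \<in> carrier G \<Longrightarrow> \<forall>p\<in>P t. g \<otimes> p \<notin> X \<Longrightarrow>
      g \<rightarrow>\<^sup>*\<^bsub>cayley_graph G S \<restriction> (carrier G - X)\<^esub> (g \<otimes> t)"
    by metis
  define B where "B = (\<Union>t\<in>T. \<Union>p\<in>P t. (\<lambda>x. x \<otimes> inv p) ` X)"
  have "finite B"
    using \<open>finite T\<close> P(1) X(1) by (auto simp: B_def)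
  moreover have "g \<rightarrow>\<^sup>*\<^bsub>cayley_graph G S \<restriction> (carrier G - X)\<^esub> (g \<otimes> t)"
    if g: "g \<in> carrier G - B" and t: "t \<in> T" for g t
  proof (rule P(2)[OF t])
    show "\<forall>p\<in>P t. g \<otimes> p \<notin> X"
    proof (intro ballI notI)
      fix p assume p: "p \<in> P t" "g \<otimes> p \<in> X"
      then have "p \<in> carrier G" using P(1)[OF t] by blast
      then have "g = (g \<otimes> p) \<otimes> inv p" using g by (simp add: m_assoc)
      with p t have "g \<in> B" unfolding B_def by blast
      with g show False by blast
    qed
  qed (use g in blast)
  ultimately show ?thesis by blast
qed

text \<open>Finitely many generators make the graph locally finite, and generation makes it
  connected, so Koenig's lemma applies at the identity.\<close>

lemma cayley_ray_exists:
  assumes S: "finite_generating_set G S" and inf: "infinite (carrier G)"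
  shows "\<exists>r. ray (cayley_graph G S) r"
proof -
  let ?\<Gamma> = "cayley_graph G S"
  have S': "finite S" "S \<subseteq> carrier G" "generate G S = carrier G"
    using S by (auto simp: finite_generating_set_def)
  have "finite (arcs_ends ?\<Gamma> `` {g})" for g
  proof (rule finite_subset)
    show "arcs_ends ?\<Gamma> `` {g} \<subseteq> (\<lambda>s. g \<otimes> s) ` S \<union> (\<lambda>s. g \<otimes> inv s) ` S"
    proof
      fix h assume "h \<in> arcs_ends ?\<Gamma> `` {g}"
      then obtain s where s: "g \<in> carrier G" "h \<in> carrier G" "s \<in> S" "h = g \<otimes> s \<or> g = h \<otimes> s"
        by (auto simp: adj_cayley_graph)
      have "s \<in> carrier G" using s(3) S'(2) by blast
      then have "h = g \<otimes> s \<or> h = g \<otimes> inv s"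
        using s by (auto simp: m_assoc)
      with s(3) show "h \<in> (\<lambda>s. g \<otimes> s) ` S \<union> (\<lambda>s. g \<otimes> inv s) ` S" by blast
    qed
  qed (use S'(1) in simp)
  moreover have "carrier G \<subseteq> (arcs_ends ?\<Gamma>)\<^sup>* `` {\<one>}"
  proof
    fix t assume "t \<in> carrier G"
    with cayley_path[OF S'(2), of t] S'(3)
    have "\<one> \<rightarrow>\<^sup>*\<^bsub>?\<Gamma> \<restriction> (carrier G - {})\<^esub> (\<one> \<otimes> t)" by blast
    then have "(\<one>, t) \<in> (arcs_ends (?\<Gamma> \<restriction> (carrier G - {})))\<^sup>*"
      using \<open>t \<in> carrier G\<close> by (simp add: reachable_rtranclI)
    moreover have "arcs_ends (?\<Gamma> \<restriction> (carrier G - {})) \<subseteq> arcs_ends ?\<Gamma>"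
      by (auto simp: arcs_ends_conv)
    ultimately show "t \<in> (arcs_ends ?\<Gamma>)\<^sup>* `` {\<one>}"
      using rtrancl_mono by blast
  qed
  then have "infinite ((arcs_ends ?\<Gamma>)\<^sup>* `` {\<one>})"
    using inf finite_subset by blast
  ultimately obtain r where r: "inj r" "\<And>n. (r n, r (Suc n)) \<in> arcs_ends ?\<Gamma>"
    using koenig[of "arcs_ends ?\<Gamma>"] by blast
  then have "range r \<subseteq> carrier G"
    by (auto simp: adj_cayley_graph)
  with r show ?thesis by (auto simp: ray_def)
qed

end


section \<open>Balanced pairs of words\<close>

lemma free_group_sel [simp]:
  "u \<otimes>\<^bsub>free_group X\<^esub> v = word_mult u v" "\<one>\<^bsub>free_group X\<^esub> = []"
  by (simp_all add: free_group_def)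

lemma carrier_free_group: "carrier (free_group X) = {w. reduced w \<and> fst ` set w \<subseteq> X}"
  by (simp add: free_group_def)

lemma letter_closed: "x \<in> X \<Longrightarrow> [(x, s)] \<in> carrier (free_group X)"
  by (simp add: carrier_free_group reduced_def)

lemma Nil_closed: "[] \<in> carrier (free_group X)"
  by (simp add: carrier_free_group)

lemma inv_letter_word:
  assumes "x \<in> X"
  shows "inv\<^bsub>free_group X\<^esub> [(x, s)] = [(x, \<not> s)]"
proof (rule group.inv_equality[OF group_free_group])
  show "[(x, \<not> s)] \<otimes>\<^bsub>free_group X\<^esub> [(x, s)] = \<one>\<^bsub>free_group X\<^esub>"
    by (simp add: word_mult_def inv_letter_def)
qed (use assms in \<open>simp_all add: letter_closed\<close>)

lemma inv_Nil: "inv\<^bsub>free_group X\<^esub> [] = []"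
  using monoid.inv_one[OF group.is_monoid[OF group_free_group[of X]]] by simp

lemma word_mult_eq_append: "reduced (u @ w) \<Longrightarrow> word_mult u w = u @ w"
proof (induction u)
  case (Cons l u)
  then have "word_mult u w = u @ w"
    using reduced_ConsD by fastforce
  with Cons.prems push_letter_reduced show ?case
    by (fastforce simp: word_mult_def)
qed (simp add: word_mult_def)

lemma reduced_appendD: "reduced (u @ w) \<Longrightarrow> reduced u \<and> reduced w"
  by (simp add: reduced_def successively_append_iff)

lemma append_closedD: "u @ w \<in> carrier (free_group X) \<Longrightarrow> u \<in> carrier (free_group X)"
  by (auto simp: carrier_free_group dest: reduced_appendD)

section \<open>Exponent sums and powers of a generator\<close>

text \<open>The exponent sum: on the free group, the homomorphism to the integers that sends each
  generator to 1.\<close>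

definition height :: "('x \<times> bool) list \<Rightarrow> int" where
  "height w = (\<Sum>l\<leftarrow>w. if snd l then 1 else - 1)"

lemma height_simps [simp]:
  "height [] = 0" "height (l # w) = (if snd l then 1 else - 1) + height w"
  "height (u @ w) = height u + height w"
  by (simp_all add: height_def)

text \<open>A cancelled pair of letters has opposite signs, so free reduction preserves the exponent
  sum.\<close>

lemma height_push_letter: "height (push_letter l w) = height [l] + height w"
  by (cases w) (auto simp: inv_letter_def)

lemma height_word_mult: "height (word_mult u v) = height u + height v"
  by (induction u) (simp_all add: word_mult_def height_push_letter)

text \<open>The integer power \<open>x^k\<close> in reduced form.\<close>

definition gen_power :: "'x \<Rightarrow> int \<Rightarrow> ('x \<times> bool) list" where
  "gen_power x k = replicate (nat \<bar>k\<bar>) (x, 0 \<le> k)"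

lemma height_replicate: "height (replicate n l) = int n * height [l]"
  by (induction n) (simp_all add: algebra_simps)

lemma gen_power_0 [simp]: "gen_power x 0 = []"
  by (simp add: gen_power_def)

lemma height_gen_power [simp]: "height (gen_power x k) = k"
  by (simp add: gen_power_def height_replicate)

lemma reduced_replicate: "reduced (replicate n l)"
  by (induction n) (auto simp: reduced_def successively_Cons)

lemma gen_power_closed: "x \<in> X \<Longrightarrow> gen_power x k \<in> carrier (free_group X)"
  by (auto simp: carrier_free_group gen_power_def reduced_replicate)

lemma word_mult_gen_power:
  "word_mult (gen_power x k) [(x, s)] = gen_power x (k + height [(x, s)])"
\<comment> \<open>Either the letter prolongs the power or it cancels the last letter.\<close>
proof (cases "k = 0 \<or> s = (0 \<le> k)")
  case True
  then have "gen_power x k @ [(x, s)] = replicate (Suc (nat \<bar>k\<bar>)) (x, s)"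
    by (auto simp: gen_power_def replicate_append_same)
  moreover from this have "word_mult (gen_power x k) [(x, s)] = gen_power x k @ [(x, s)]"
    by (intro word_mult_eq_append) (metis reduced_replicate)
  moreover have "Suc (nat \<bar>k\<bar>) = nat \<bar>k + height [(x, s)]\<bar>" "s = (0 \<le> k + height [(x, s)])"
    using True by auto
  ultimately show ?thesis by (simp add: gen_power_def)
next
  case False
  then obtain n where n: "nat \<bar>k\<bar> = Suc n"
    by (metis abs_eq_0 gr0_conv_Suc zero_less_nat_eq zero_less_abs_iff)
  let ?l = "(x, 0 \<le> k)"
  have "word_mult [?l] [(x, s)] = []"
    using False by (auto simp: word_mult_def inv_letter_def)
  moreover have "gen_power x k = replicate n ?l @ [?l]"
    by (simp add: gen_power_def n replicate_append_same)
  ultimately have "word_mult (gen_power x k) [(x, s)] = word_mult (replicate n ?l) []"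
    by (simp add: word_mult_def)
  also have "\<dots> = replicate n ?l"
    by (rule word_mult_Nil_right[OF reduced_replicate])
  also have "\<dots> = gen_power x (k + height [(x, s)])"
  \<comment> \<open>At \<open>n = 0\<close> the new exponent is 0 and the sign flag may flip (from
    \<open>k = - 1\<close>), but the word is empty; for larger \<open>n\<close> the sign is
    kept.\<close>
  proof (cases "n = 0")
    case True
    with n False have "k + height [(x, s)] = 0" by auto
    with True show ?thesis by simp
  next
    case False
    with n \<open>\<not> (k = 0 \<or> s = (0 \<le> k))\<close>
    have "nat \<bar>k + height [(x, s)]\<bar> = n" "(0 \<le> k + height [(x, s)]) = (0 \<le> k)"
      by auto
    then show ?thesis by (simp add: gen_power_def)
  qed
  finally show ?thesis .
qed

lemma gen_power_mult_inverse: "word_mult (gen_power x k) (gen_power x (- k)) = []"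
proof (cases "k = 0")
  case False
  then have "gen_power x k = rev (map inv_letter (gen_power x (- k)))"
    by (auto simp: gen_power_def inv_letter_def)
  then show ?thesis
    by (metis word_mult_inverse_word gen_power_def reduced_replicate)
qed (simp add: word_mult_def)

text \<open>The kernel of \<open>height u + height v\<close>: the Bieri-Stallings group when both
  alphabets have two elements. Arbitrary alphabets allow the factors to be exchanged.\<close>

definition balanced :: "'x set \<Rightarrow> 'y set \<Rightarrow> (('x \<times> bool) list \<times> ('y \<times> bool) list) set" where
  "balanced X Y =
     {(u, v). u \<in> carrier (free_group X) \<and> v \<in> carrier (free_group Y) \<and> height u + height v = 0}"

lemma free_group_mult_closed:
  assumes "u \<in> carrier (free_group X)" "v \<in> carrier (free_group X)"
  shows "word_mult u v \<in> carrier (free_group X)"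
  using monoid.m_closed[OF group.is_monoid[OF group_free_group] assms] by simp

lemma balanced_mult_closed:
  assumes "(u, v) \<in> balanced X Y" "(u', v') \<in> balanced X Y"
  shows "(word_mult u u', word_mult v v') \<in> balanced X Y"
  using assms by (auto simp: balanced_def height_word_mult free_group_mult_closed)

lemma letters_balanced:
  "x \<in> X \<Longrightarrow> y \<in> Y \<Longrightarrow> ([(x, s)], [(y, \<not> s)]) \<in> balanced X Y"
  by (simp add: balanced_def letter_closed)

section \<open>Connectivity outside a box\<close>

text \<open>The equivalence relation generated by multiplication with letters of opposite sign,
  starting outside the box of words of length at most \<open>n\<close>. Only the start of a step is
  restricted: for a large enough box this already yields a graph path, endpoint included, off the
  removed set.\<close>

inductive far_connected :: "'x set \<Rightarrow> 'y set \<Rightarrow> nat \<Rightarrow> ('x \<times> bool) list \<Rightarrow> ('y \<times> bool) list \<Rightarrow>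
    ('x \<times> bool) list \<Rightarrow> ('y \<times> bool) list \<Rightarrow> bool" for X Y n where
  refl: "far_connected X Y n u v u v"
| sym: "far_connected X Y n u v u' v' \<Longrightarrow> far_connected X Y n u' v' u v"
| trans: "far_connected X Y n u v u' v' \<Longrightarrow> far_connected X Y n u' v' u'' v'' \<Longrightarrow>
    far_connected X Y n u v u'' v''"
| step: "(u, v) \<in> balanced X Y \<Longrightarrow> n < length u \<or> n < length v \<Longrightarrow> x \<in> X \<Longrightarrow> y \<in> Y \<Longrightarrow>
    far_connected X Y n u v (word_mult u [(x, s)]) (word_mult v [(y, \<not> s)])"

text \<open>The sign flips along with the factors, so a result on moving one coordinate serves for
  the other too.\<close>

lemma far_connected_swap:
  "far_connected X Y n u v u' v' \<Longrightarrow> far_connected Y X n v u v' u'"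
proof (induction rule: far_connected.induct)
  case (step u v x y s)
  then show ?case
    using far_connected.step[of v u Y X n y x "\<not> s"] by (auto simp: balanced_def)
qed (blast intro: far_connected.intros)+

text \<open>Every intermediate first word has the prefix \<open>u\<close>, hence length above
  \<open>n\<close>, so each step is allowed; powers of \<open>y\<close> absorb the change of
  height.\<close>

lemma far_connected_extend:
  assumes "n < length u" "u @ w \<in> carrier (free_group X)" "(u, v) \<in> balanced X Y" "y \<in> Y"
  shows "far_connected X Y n u v (u @ w) (word_mult v (gen_power y (- height w)))"
  using assms(2)
proof (induction w rule: rev_induct)
  case Nil
  have "word_mult v [] = v"
    using assms(3) by (simp add: word_mult_Nil_right balanced_def carrier_free_group)
  then show ?case by (simp add: far_connected.refl)
next
  case (snoc l w)
  obtain x s where l: "l = (x, s)" by fastforce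
  have uw: "u @ w \<in> carrier (free_group X)" and "x \<in> X" and red: "reduced ((u @ w) @ [(x, s)])"
    using snoc.prems append_closedD[of "u @ w" "[l]" X] by (auto simp: carrier_free_group l)
  let ?v = "word_mult v (gen_power y (- height w))"
  have v: "v \<in> carrier (free_group Y)"
    using assms(3) by (simp add: balanced_def)
  have "(u @ w, ?v) \<in> balanced X Y"
    using assms(3,4) uw by (auto simp: balanced_def free_group_mult_closed gen_power_closed height_word_mult)
  then have "far_connected X Y n (u @ w) ?v (word_mult (u @ w) [(x, s)]) (word_mult ?v [(y, \<not> s)])"
    using assms(1,4) \<open>x \<in> X\<close> by (intro far_connected.step) auto
  moreover have "word_mult (u @ w) [(x, s)] = u @ w @ [l]"
    using word_mult_eq_append[OF red] by (simp add: l)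
  moreover have "word_mult ?v [(y, \<not> s)] = word_mult v (gen_power y (- height (w @ [l])))"
    using gen_power_closed[OF assms(4), of "- height w"]
    by (subst word_mult_assoc) (auto simp: word_mult_gen_power l carrier_free_group reduced_def intro!: arg_cong[of _ _ "\<lambda>k. word_mult v (gen_power y k)"])
  ultimately show ?case
    using snoc.IH[OF uw] by (metis far_connected.trans)
qed

text \<open>Since \<open>X\<close> has two elements, \<open>u\<close> can be prolonged by a letter of either sign.\<close>

lemma far_connected_move:
  assumes "n < length u" "(u, v) \<in> balanced X Y" and X: "a \<in> X" "b \<in> X" "a \<noteq> b"
    and p: "p \<in> carrier (free_group Y)"
  shows "\<exists>w. (u @ w, word_mult v p) \<in> balanced X Y \<and> far_connected X Y n u v (u @ w) (word_mult v p)"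
  using p
proof (induction p rule: rev_induct)
  case Nil
  have "word_mult v [] = v"
    using assms(2) by (simp add: word_mult_Nil_right balanced_def carrier_free_group)
  with assms(2) show ?case
    by (intro exI[of _ "[]"]) (simp add: far_connected.refl)
next
  case (snoc m p)
  obtain y s where m: "m = (y, s)" by fastforce
  have p: "p \<in> carrier (free_group Y)" and "y \<in> Y" and red: "reduced (p @ [m])"
    using snoc.prems append_closedD[of p "[m]" Y] by (auto simp: carrier_free_group m)
  obtain w where w: "(u @ w, word_mult v p) \<in> balanced X Y"
      "far_connected X Y n u v (u @ w) (word_mult v p)"
    using snoc.IH[OF p] by blast
  have "u @ w \<noteq> []" using assms(1) by auto
  \<comment> \<open>A generator different from that of the last letter cancels with neither
    sign.\<close>
  obtain x where x: "x \<in> X" "x \<noteq> fst (last (u @ w))"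
    using X by metis
  have "reduced (u @ w)"
    using w(1) by (simp add: balanced_def carrier_free_group)
  with x \<open>u @ w \<noteq> []\<close> have "reduced ((u @ w) @ [(x, \<not> s)])"
    unfolding reduced_def successively_append_iff[of _ "u @ w"] by (auto simp: inv_letter_def)
  then have eq: "word_mult (u @ w) [(x, \<not> s)] = u @ (w @ [(x, \<not> s)])"
    by (simp add: word_mult_eq_append)
  have eq': "word_mult (word_mult v p) [m] = word_mult v (p @ [m])"
    using word_mult_assoc[of p "[m]" v] word_mult_eq_append[OF red] reduced_appendD[OF red] by simp
  have "(u @ (w @ [(x, \<not> s)]), word_mult v (p @ [m])) \<in> balanced X Y"
    using balanced_mult_closed[OF w(1) letters_balanced[OF x(1) \<open>y \<in> Y\<close>, of "\<not> s"]] eq eq'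
    by (simp add: m)
  moreover have "far_connected X Y n (u @ w) (word_mult v p) (u @ (w @ [(x, \<not> s)])) (word_mult v (p @ [m]))"
    using far_connected.step[OF w(1) _ x(1) \<open>y \<in> Y\<close>, of n "\<not> s"] assms(1) eq eq' by (simp add: m)
  ultimately show ?case
    using far_connected.trans[OF w(2)] by blast
qed

text \<open>Multiplying \<open>v\<close> on the right by its inverse times \<open>v'\<close> gives
  \<open>v'\<close>, so this is \<open>far_connected_move\<close> for that factor.\<close>

lemma far_connected_move_to:
  assumes "n < length u" "(u, v) \<in> balanced X Y" "a \<in> X" "b \<in> X" "a \<noteq> b"
    and v': "v' \<in> carrier (free_group Y)"
  shows "\<exists>w. (u @ w, v') \<in> balanced X Y \<and> far_connected X Y n u v (u @ w) v'"
proof -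
  interpret G: group "free_group Y" by (rule group_free_group)
  let ?p = "inv\<^bsub>free_group Y\<^esub> v \<otimes>\<^bsub>free_group Y\<^esub> v'"
  have v: "v \<in> carrier (free_group Y)"
    using assms(2) by (simp add: balanced_def)
  then have "v \<otimes>\<^bsub>free_group Y\<^esub> ?p = v'"
    using v' by (simp add: G.m_assoc[symmetric] del: free_group_sel)
  moreover have "?p \<in> carrier (free_group Y)"
    using v v' by (simp del: free_group_sel)
  ultimately show ?thesis
    using far_connected_move[OF assms(1-5), of ?p] by simp
qed

text \<open>
  Move \<open>v\<close> to \<open>v'\<close> while prolonging \<open>u\<close>, then retract the prolongation while the second coordinate
  runs along powers of \<open>y\<close>: the exponent is zero at the end because heights balance.
\<close>

lemma far_connected_common_prefix:
  assumes n: "n < length u" and uw: "(u @ w, v) \<in> balanced X Y" "(u @ w', v') \<in> balanced X Y"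
    and X: "a \<in> X" "b \<in> X" "a \<noteq> b" and y: "y \<in> Y"
  shows "far_connected X Y n (u @ w) v (u @ w') v'"
proof -
  have v': "v' \<in> carrier (free_group Y)" and u: "u \<in> carrier (free_group X)"
    using uw by (auto simp: balanced_def dest: append_closedD)
  obtain z where z: "((u @ w) @ z, v') \<in> balanced X Y"
    "far_connected X Y n (u @ w) v ((u @ w) @ z) v'"
    using far_connected_move_to[OF _ uw(1) X v', of n] n by auto
  \<comment> \<open>The second word that belongs to \<open>u\<close> once \<open>w'\<close> is
    stripped off: the height lost in the first coordinate reappears as a power of
    \<open>y\<close>.\<close>
  let ?v = "word_mult v' (gen_power y (height w'))"
  have "(u, ?v) \<in> balanced X Y"
    using uw(2) u v' y
    by (auto simp: balanced_def free_group_mult_closed gen_power_closed height_word_mult)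
  have retract: "far_connected X Y n u ?v (u @ t) v'" if "(u @ t, v') \<in> balanced X Y" for t
  proof -
    have "height t = height w'"
      using that uw(2) by (auto simp: balanced_def)
    have "word_mult ?v (gen_power y (- height t)) = v'"
      using v' gen_power_closed[OF y] \<open>height t = height w'\<close>
      by (simp add: word_mult_assoc carrier_free_group gen_power_mult_inverse word_mult_Nil_right)
    moreover have "u @ t \<in> carrier (free_group X)"
      using that by (simp add: balanced_def)
    ultimately show ?thesis
      using far_connected_extend[OF n _ \<open>(u, ?v) \<in> balanced X Y\<close> y, of t] by simp
  qed
  \<comment> \<open>\<open>retract\<close> extends from \<open>u\<close>; it is run backwards for
    \<open>w @ z\<close> and forwards for \<open>w'\<close>.\<close>
  show ?thesis
    using far_connected.trans[OF z(2)] far_connected.sym[OF retract[of "w @ z"]] z(1)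
      retract[OF uw(2)] by (metis append.assoc far_connected.trans)
qed

text \<open>Every pair is led to one with second word \<open>v0\<close>, of length
  \<open>n + 1\<close>; if only \<open>v\<close> is long, \<open>u\<close> is first moved to the
  long \<open>u0\<close>. Two pairs with second word \<open>v0\<close> are then joined.\<close>

lemma far_connected_outside_box:
  assumes "(u, v) \<in> balanced X Y" "n < length u \<or> n < length v"
    and "(u', v') \<in> balanced X Y" "n < length u' \<or> n < length v'"
    and X: "a \<in> X" "b \<in> X" "a \<noteq> b" and Y: "c \<in> Y" "d \<in> Y" "c \<noteq> d"
  shows "far_connected X Y n u v u' v'"
proof -
  define u0 where "u0 = gen_power a (int (Suc n))"
  define v0 where "v0 = gen_power c (int (Suc n))"
  have u0: "n < length u0" "u0 \<in> carrier (free_group X)"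
    and v0: "n < length v0" "v0 \<in> carrier (free_group Y)"
    using X Y by (auto simp: u0_def v0_def gen_power_closed) (simp_all add: gen_power_def)
  have swap: "(v, u) \<in> balanced Y X \<longleftrightarrow> (u, v) \<in> balanced X Y" for u v
    by (auto simp: balanced_def)
  have *: "\<exists>u1. (u1, v0) \<in> balanced X Y \<and> far_connected X Y n u v u1 v0"
    if uv: "(u, v) \<in> balanced X Y" and u: "n < length u" for u v
    using far_connected_move_to[OF u uv X v0(2)] by blast
  have **: "\<exists>u1. (u1, v0) \<in> balanced X Y \<and> far_connected X Y n u v u1 v0"
    if uv: "(u, v) \<in> balanced X Y" and "n < length u \<or> n < length v" for u v
  proof (cases "n < length u")
    case False
    then have v: "n < length v" using that by simp
    obtain w where w: "(v @ w, u0) \<in> balanced Y X" "far_connected Y X n v u (v @ w) u0"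
      using far_connected_move_to[OF v _ Y u0(2), of u] uv by (auto simp: swap)
    with *[of u0 "v @ w"] u0(1) show ?thesis
      using far_connected_swap[OF w(2)] by (auto simp: swap intro: far_connected.trans)
  qed (use * uv in blast)
  obtain u1 where u1: "(u1, v0) \<in> balanced X Y" "far_connected X Y n u v u1 v0"
    using **[OF assms(1,2)] by blast
  obtain u2 where u2: "(u2, v0) \<in> balanced X Y" "far_connected X Y n u' v' u2 v0"
    using **[OF assms(3,4)] by blast
  \<comment> \<open>With the factors exchanged, the whole of \<open>v0\<close> is the common prefix
    and both suffixes are empty.\<close>
  have "far_connected Y X n v0 u1 v0 u2"
    using far_connected_common_prefix[OF v0(1), of "[]" u1 Y X "[]" u2 c d a] u1(1) u2(1) X Y
    by (simp add: swap)
  then show ?thesis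
    using far_connected_swap u1(2) u2(2) by (blast intro: far_connected.trans far_connected.sym)
qed

section \<open>The Bieri--Stallings group\<close>

lemma height_inv:
  assumes "w \<in> carrier (free_group X)"
  shows "height (inv\<^bsub>free_group X\<^esub> w) = - height w"
  using group.l_inv[OF group_free_group assms] height_word_mult[of "inv\<^bsub>free_group X\<^esub> w" w] by simp

lemma subgroup_balanced: "subgroup (balanced X Y) (free_group X \<times>\<times> free_group Y)"
proof (rule group.subgroupI[OF DirProd_group[OF group_free_group group_free_group]])
  show "balanced X Y \<subseteq> carrier (free_group X \<times>\<times> free_group Y)"
    by (auto simp: balanced_def)
  have "([], []) \<in> balanced X Y"
    by (simp add: balanced_def carrier_free_group)
  then show "balanced X Y \<noteq> {}" by blast
  show "inv\<^bsub>free_group X \<times>\<times> free_group Y\<^esub> g \<in> balanced X Y" if "g \<in> balanced X Y" for g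
    using that
    by (cases g) (auto simp: balanced_def height_inv inv_DirProd[OF group_free_group group_free_group]
        group.inv_closed[OF group_free_group])
  show "g \<otimes>\<^bsub>free_group X \<times>\<times> free_group Y\<^esub> h \<in> balanced X Y"
    if "g \<in> balanced X Y" "h \<in> balanced X Y" for g h
    using that balanced_mult_closed by (cases g; cases h) simp
qed

lemma inv_letter_pair:
  "x \<in> X \<Longrightarrow> inv\<^bsub>free_group X \<times>\<times> free_group Y\<^esub> ([(x, s)], []) = ([(x, \<not> s)], [])"
  "y \<in> Y \<Longrightarrow> inv\<^bsub>free_group X \<times>\<times> free_group Y\<^esub> ([], [(y, s)]) = ([], [(y, \<not> s)])"
  by (simp_all add: inv_DirProd[OF group_free_group group_free_group] letter_closed Nil_closed
      inv_letter_word inv_Nil)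

text \<open>Inverses turn the given pairs into all pairs of letters of opposite sign. Words are then
  built letter by letter, a power in the other coordinate keeping the balance. \<open>S\<close> may
  hold further balanced pairs, so both the letter pairs and the six generators are covered.\<close>

lemma generate_eq_balanced:
  assumes S: "S \<subseteq> balanced X Y" and "X \<noteq> {}" "Y \<noteq> {}"
    and gens: "\<And>x y. x \<in> X \<Longrightarrow> y \<in> Y \<Longrightarrow> ([(x, False)], [(y, True)]) \<in> S"
  shows "generate (free_group X \<times>\<times> free_group Y) S = balanced X Y"
proof
  let ?F = "free_group X \<times>\<times> free_group Y"
  let ?K = "generate ?F S"
  interpret F: group ?F by (rule DirProd_group[OF group_free_group group_free_group])
  show "?K \<subseteq> balanced X Y"
    by (rule F.generate_subgroup_incl[OF S subgroup_balanced])
  have mult: "(word_mult u u', word_mult v v') \<in> ?K" if "(u, v) \<in> ?K" "(u', v') \<in> ?K" for u v u' v'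
    using generate.eng[OF that] by simp
  have letters: "([(x, s)], [(y, \<not> s)]) \<in> ?K" if "x \<in> X" "y \<in> Y" for x y s
  proof (cases s)
    case True
    then show ?thesis
      using generate.inv[OF gens[OF that], of ?F] that
      by (simp add: inv_DirProd[OF group_free_group group_free_group] letter_closed inv_letter_word)
  next
    case False
    then show ?thesis
      using generate.incl[OF gens[OF that], of ?F] by simp
  qed
  obtain x y where x: "x \<in> X" and y: "y \<in> Y"
    using assms by blast
  have left: "(u, gen_power y (- height u)) \<in> ?K" if "u \<in> carrier (free_group X)" for u
    using that
  proof (induction u rule: rev_induct)
    case Nil
    show ?case using generate.one[of ?F S] by simp
  next
    case (snoc l u)
    obtain x' s where l: "l = (x', s)" by fastforce
    have "u \<in> carrier (free_group X)" "x' \<in> X" "reduced (u @ [(x', s)])"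
      using snoc.prems append_closedD[of u "[l]" X] by (auto simp: carrier_free_group l)
    with mult[OF snoc.IH letters[OF _ y, of x' s]] show ?case
      by (cases s) (simp_all add: word_mult_eq_append word_mult_gen_power l algebra_simps)
  qed
  have right: "(gen_power x (- height v), v) \<in> ?K" if "v \<in> carrier (free_group Y)" for v
    using that
  proof (induction v rule: rev_induct)
    case Nil
    show ?case using generate.one[of ?F S] by simp
  next
    case (snoc l v)
    obtain y' s where l: "l = (y', s)" by fastforce
    have "v \<in> carrier (free_group Y)" "y' \<in> Y" "reduced (v @ [(y', s)])"
      using snoc.prems append_closedD[of v "[l]" Y] by (auto simp: carrier_free_group l)
    with mult[OF snoc.IH letters[OF x, of y' "\<not> s"]] show ?case
      by (cases s) (simp_all add: word_mult_eq_append word_mult_gen_power l algebra_simps)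
  qed
  show "balanced X Y \<subseteq> ?K"
  proof
    fix g assume "g \<in> balanced X Y"
    then obtain u v where g: "g = (u, v)" and uv: "u \<in> carrier (free_group X)"
      "v \<in> carrier (free_group Y)" "height u + height v = 0"
      by (auto simp: balanced_def)
    \<comment> \<open>\<open>(u, v)\<close> is the product of \<open>(u, y^k)\<close>,
      \<open>(x^k, y^-k)\<close> and \<open>(x^-k, v)\<close>; the middle factor cancels both stray
      powers.\<close>
    define k where "k = height v"
    have hu: "height u = - k" using uv(3) by (simp add: k_def)
    have red: "reduced u" "reduced v" using uv by (auto simp: carrier_free_group)
    have 1: "(u, gen_power y k) \<in> ?K" using left[OF uv(1)] hu by simp
    have 2: "(gen_power x k, gen_power y (- k)) \<in> ?K"
      using left[OF gen_power_closed[OF x], of k] by simp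
    have 3: "(gen_power x (- k), v) \<in> ?K" using right[OF uv(2)] by (simp add: k_def)
    have cancel: "word_mult (word_mult u (gen_power x k)) (gen_power x (- k)) = u"
      using gen_power_closed[OF x] red
      by (simp add: word_mult_assoc carrier_free_group gen_power_mult_inverse word_mult_Nil_right)
    show "g \<in> ?K"
      using mult[OF mult[OF 1 2] 3] cancel
      by (simp add: gen_power_mult_inverse word_mult_Nil_left g)
  qed
qed

text \<open>The pairs of powers \<open>(x^k, y^-k)\<close> are told apart by the height of their
  first word.\<close>

lemma infinite_balanced:
  assumes "x \<in> X" "y \<in> Y"
  shows "infinite (balanced X Y)"
proof
  assume "finite (balanced X Y)"
  moreover have "(\<lambda>k. (gen_power x k, gen_power y (- k))) ` UNIV \<subseteq> balanced X Y"
    using assms by (auto simp: balanced_def gen_power_closed)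
  moreover have "inj (\<lambda>k. (gen_power x k, gen_power y (- k)))"
    by (rule injI) (metis height_gen_power prod.inject)
  ultimately show False
    using finite_imageD finite_subset infinite_UNIV_int by metis
qed

text \<open>Connectivity is known for the letter pairs \<open>T\<close>; replacing each
  \<open>T\<close>-edge by a bounded path over \<open>S\<close> carries it to an arbitrary finite
  generating set.\<close>

lemma one_ended_balanced:
  assumes fin: "finite X" "finite Y" and X: "a \<in> X" "b \<in> X" "a \<noteq> b" and Y: "c \<in> Y" "d \<in> Y" "c \<noteq> d"
  shows "one_ended ((free_group X \<times>\<times> free_group Y)\<lparr>carrier := balanced X Y\<rparr>)"
proof -
  let ?F = "free_group X \<times>\<times> free_group Y"
  let ?B = "?F\<lparr>carrier := balanced X Y\<rparr>"
  interpret F: group ?F by (rule DirProd_group[OF group_free_group group_free_group])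
  interpret B: group ?B by (rule F.subgroup_imp_group[OF subgroup_balanced])
  define T where "T = (\<lambda>(x, y, s). ([(x, s)], [(y, \<not> s)])) ` (X \<times> Y \<times> (UNIV :: bool set))"
  have T: "finite T" "T \<subseteq> balanced X Y"
    using fin by (auto simp: T_def letters_balanced)
  have inf: "infinite (carrier ?B)"
    using infinite_balanced[OF X(1) Y(1)] by simp
  have "generate ?F T = balanced X Y"
  proof (rule generate_eq_balanced[OF T(2)])
    show "([(x, False)], [(y, True)]) \<in> T" if "x \<in> X" "y \<in> Y" for x y
      using that unfolding T_def by (intro image_eqI[of _ _ "(x, y, False)"]) auto
  qed (use X Y in auto)
  then have gen: "finite_generating_set ?B T"
    using T F.generate_consistent[OF T(2) subgroup_balanced] by (simp add: finite_generating_set_def)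
  have "card (ends (cayley_graph ?B S)) = 1" if S: "finite_generating_set ?B S" for S
  proof -
    obtain r where r: "ray (cayley_graph ?B S) r"
      using B.cayley_ray_exists[OF S inf] by blast
    show ?thesis
    proof (rule card_ends_eq_1[OF r], unfold verts_cayley_graph)
      fix Z assume Z: "finite Z" "Z \<subseteq> carrier ?B"
      let ?\<Gamma> = "cayley_graph ?B S \<restriction> (carrier ?B - Z)"
      \<comment> \<open>Outside the finite set \<open>D\<close>, every \<open>T\<close>-edge becomes
        a path over \<open>S\<close> that avoids \<open>Z\<close>.\<close>
      obtain D where D: "finite D" "\<And>g t. g \<in> carrier ?B - D \<Longrightarrow> t \<in> T \<Longrightarrow> g \<rightarrow>\<^sup>*\<^bsub>?\<Gamma>\<^esub> (g \<otimes>\<^bsub>?B\<^esub> t)"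
        using B.cayley_path_avoiding[OF S T(1) _ Z] T(2) by auto
      \<comment> \<open>The box is made large enough to contain \<open>D\<close>, so a pair outside
        the box is outside \<open>D\<close>.\<close>
      obtain n where n: "\<And>u v. (u, v) \<in> D \<Longrightarrow> length u \<le> n \<and> length v \<le> n"
      proof -
        have "finite ((length \<circ> fst) ` D \<union> (length \<circ> snd) ` D)" using D(1) by simp
        then obtain n where "\<forall>k\<in>(length \<circ> fst) ` D \<union> (length \<circ> snd) ` D. k \<le> n"
          using finite_nat_set_iff_bounded_le by blast
        then show ?thesis by (intro that[of n]) force
      qed
      have step: "(u, v) \<rightarrow>\<^sup>*\<^bsub>?\<Gamma>\<^esub> (word_mult u [(x, s)], word_mult v [(y, \<not> s)])"
        if "(u, v) \<in> balanced X Y" "n < length u \<or> n < length v" "x \<in> X" "y \<in> Y" for u v x y s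
      proof -
        have "(u, v) \<notin> D" using n[of u v] that(2) by auto
        moreover have "([(x, s)], [(y, \<not> s)]) \<in> T" using that by (force simp: T_def)
        ultimately show ?thesis using D(2)[of "(u, v)"] that(1) by fastforce
      qed
      \<comment> \<open>Equality is listed separately because the rule \<open>refl\<close> also
        covers pairs in \<open>Z\<close>, which are not vertices of the remaining graph.\<close>
      have path: "(u, v) = (u', v') \<or> (u, v) \<rightarrow>\<^sup>*\<^bsub>?\<Gamma>\<^esub> (u', v')"
        if "far_connected X Y n u v u' v'" for u v u' v'
        using that
      proof (induction rule: far_connected.induct)
        case (sym u v u' v')
        then show ?case
          using symmetric_reachable[OF symmetric_induce_subgraph[OF cayley_graph_wf_symmetric(2)]]
          by metis
      next
        case (trans u v u' v' u'' v'')
        then show ?case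
          using wf_digraph.reachable_trans[OF B.wf_digraph_cayley_minus] by metis
      qed (use step in auto)
      define box where "box = {u. set u \<subseteq> X \<times> (UNIV :: bool set) \<and> length u \<le> n} \<times> {v. set v \<subseteq> Y \<times> (UNIV :: bool set) \<and> length v \<le> n}"
      have "finite box"
        using fin by (auto simp: box_def intro!: finite_cartesian_product finite_lists_length_le)
      have outside: "n < length u \<or> n < length v" if "(u, v) \<in> balanced X Y" "(u, v) \<notin> box" for u v
        using that by (fastforce simp: box_def balanced_def carrier_free_group)
      \<comment> \<open>Excluding \<open>Z\<close> along with the box makes every element considered
        a vertex of the remaining graph, which settles \<open>g = h\<close>.\<close>
      have "g \<rightarrow>\<^sup>*\<^bsub>?\<Gamma>\<^esub> h" if g: "g \<in> carrier ?B - (box \<union> Z)" and h: "h \<in> carrier ?B - (box \<union> Z)" for g h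
      proof -
        obtain u v u' v' where eq: "g = (u, v)" "h = (u', v')" by fastforce
        have "far_connected X Y n u v u' v'"
          using g h outside X Y unfolding eq by (intro far_connected_outside_box) auto
        then have "g = h \<or> g \<rightarrow>\<^sup>*\<^bsub>?\<Gamma>\<^esub> h" using path eq by simp
        moreover have "g \<rightarrow>\<^sup>*\<^bsub>?\<Gamma>\<^esub> g"
          using g wf_digraph.reachable_refl[OF B.wf_digraph_cayley_minus] by simp
        ultimately show ?thesis by metis
      qed
      then show "\<exists>W. finite W \<and> (\<forall>g\<in>carrier ?B - W. \<forall>h\<in>carrier ?B - W. g \<rightarrow>\<^sup>*\<^bsub>?\<Gamma>\<^esub> h)"
        using \<open>finite box\<close> Z(1) by (intro exI[of _ "box \<union> Z"]) blast
    qed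
  qed
  with gen show ?thesis
    unfolding one_ended_def by blast
qed

theorem lemma5p2:
  fixes a b :: 'x and c d :: 'y
  assumes "a \<noteq> b" and "c \<noteq> d"
  shows
    "let F = free_group {a, b} \<times>\<times> free_group {c, d};
         A = (free_gen a, \<one>\<^bsub>free_group {c, d}\<^esub>);
         B = (free_gen b, \<one>\<^bsub>free_group {c, d}\<^esub>);
         C = (\<one>\<^bsub>free_group {a, b}\<^esub>, free_gen c);
         D = (\<one>\<^bsub>free_group {a, b}\<^esub>, free_gen d);
         K = generate F
               {B \<otimes>\<^bsub>F\<^esub> inv\<^bsub>F\<^esub> A, C \<otimes>\<^bsub>F\<^esub> inv\<^bsub>F\<^esub> A, D \<otimes>\<^bsub>F\<^esub> inv\<^bsub>F\<^esub> A,
                C \<otimes>\<^bsub>F\<^esub> inv\<^bsub>F\<^esub> B, D \<otimes>\<^bsub>F\<^esub> inv\<^bsub>F\<^esub> B, D \<otimes>\<^bsub>F\<^esub> inv\<^bsub>F\<^esub> C}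
     in one_ended (F\<lparr>carrier := K\<rparr>)"
proof -
  let ?F = "free_group {a, b} \<times>\<times> free_group {c, d}"
  have inv: "inv\<^bsub>?F\<^esub> ([(a, True)], []) = ([(a, False)], [])"
    "inv\<^bsub>?F\<^esub> ([(b, True)], []) = ([(b, False)], [])"
    "inv\<^bsub>?F\<^esub> ([], [(c, True)]) = ([], [(c, False)])"
    by (simp_all add: inv_letter_pair)
  \<comment> \<open>The six generators as pairs of reduced words. The four that mix the factors are
    the letter pairs required by \<open>generate_eq_balanced\<close>; the other two are further
    balanced pairs.\<close>
  have "generate ?F
      {([(b, True), (a, False)], []), ([(a, False)], [(c, True)]), ([(a, False)], [(d, True)]),
       ([(b, False)], [(c, True)]), ([(b, False)], [(d, True)]), ([], [(d, True), (c, False)])}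
      = balanced {a, b} {c, d}"
    using assms
    by (intro generate_eq_balanced) (auto simp: balanced_def carrier_free_group reduced_def inv_letter_def)
  with one_ended_balanced[of "{a, b}" "{c, d}" a b c d] assms show ?thesis
    by (simp add: Let_def free_gen_def inv word_mult_def inv_letter_def)
qed

end
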